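(* Let $\Lambda_{\mathcal N}\subseteq\mathbb S^2\cap\mathbb Q^3$ be the finite set of the context. There exist $\varepsilon_m>0$, a finite set $\Lambda_m\subseteq\mathbb S^2\cap\mathbb Q^3$ consisting of vectors $k$, each equipped with an orthonormal basis $(k,k_1,k_2)$ of $\mathbb R^3$ with $k,k_1,k_2\in\mathbb S^2\cap\mathbb Q^3$, subsets with $\Lambda_m=\Lambda_{m^1}\cup\Lambda_{m^2}$ and $\Lambda_{m^2}=\Lambda_{m^2_1}\cup\Lambda_{m^2_2}\cup\Lambda_{m^2_3}$, and smooth positive functions $\gamma_{(k)}:B_{{\rm sym},3}(0,\varepsilon_m)\to\mathbb R$, $k\in\Lambda_m$, such that for any $S\in B_{{\rm sym},3}(0,\varepsilon_m)$ we have $$S=\sum_{k\in\Lambda_{m^1}}\gamma_{(k)}^2(S)\,(k_1\otimes k_1)-\sum_{i=1}^3\ \sum_{k\in\Lambda_{m^2_i}}\gamma_{(k)}^2(S)\,(k_2\otimes k_2).$$ Furthermore, $\Lambda_m,\Lambda_{m^1},\Lambda_{m^2}$ may be chosen such that $\Lambda_{\mathcal N}\cap\Lambda_m=\varnothing$ and $\Lambda_{m^1}\cap\Lambda_{m^2}=\varnothing$.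
   Context: $B_{{\rm sym},3}(0,\varepsilon_m)$ is the ball of radius $\varepsilon_m$ centered at $0$ in the space of real symmetric $3\times3$ matrices. $\Lambda_{\mathcal N}=\Lambda_{\mathcal N^1}\cup\Lambda_{\mathcal N^2}\cup\Lambda_{\mathcal N^3}$ is a given finite subset of $\mathbb S^2\cap\mathbb Q^3$ (the $\Lambda_{\mathcal N^i}$ being pairwise disjoint): it is the set of directions for which each skew-symmetric $3\times3$ matrix $A^i$ in a small ball around $0$ is written as $A^i=\sum_{k\in\Lambda_{\mathcal N^i}}\gamma_{(k)}^2(A^i)(k_2\otimes k_1-k_1\otimes k_2)$ with smooth positive $\gamma_{(k)}$ and orthonormal rational bases $(k,k_1,k_2)$. *)

theory Defs
  imports "HOL-Analysis.Analysis"
begin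

definition rational_sphere :: "(real^3) set" where
  "rational_sphere = {k \<in> sphere 0 1. \<forall>i. k $ i \<in> \<rat>}"

definition orthonormal_basis3 :: "real^3 \<Rightarrow> real^3 \<Rightarrow> real^3 \<Rightarrow> bool" where
  "orthonormal_basis3 u v w \<longleftrightarrow>
     norm u = 1 \<and> norm v = 1 \<and> norm w = 1 \<and>
     u \<bullet> v = 0 \<and> u \<bullet> w = 0 \<and> v \<bullet> w = 0 \<and>
     span {u, v, w} = UNIV"

text \<open>No orientation of the basis is imposed.\<close>

definition rational_orthonormal_basis :: "real^3 \<Rightarrow> real^3 \<Rightarrow> real^3 \<Rightarrow> bool" where
  "rational_orthonormal_basis u v w \<longleftrightarrow>
     orthonormal_basis3 u v w \<and> {u, v, w} \<subseteq> rational_sphere"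

definition tensor :: "real^'n \<Rightarrow> real^'m \<Rightarrow> real^'m^'n"  (infixl "\<otimes>" 70) where
  "u \<otimes> v = (\<chi> i j. u $ i * v $ j)"

definition Sym3 :: "(real^3^3) set" where
  "Sym3 = {S. transpose S = S}"

definition Skew3 :: "(real^3^3) set" where
  "Skew3 = {A. transpose A = - A}"

text \<open>The norm on \<^typ>\<open>real^3^3\<close> is the Frobenius norm; the balls are open, so that
  smoothness on them needs no convention at the boundary.\<close>

definition B_sym3 :: "real \<Rightarrow> (real^3^3) set" where
  "B_sym3 \<epsilon> = Sym3 \<inter> ball 0 \<epsilon>"

definition B_skew3 :: "real \<Rightarrow> (real^3^3) set" where
  "B_skew3 \<epsilon> = Skew3 \<inter> ball 0 \<epsilon>"

text \<open>
  \<open>Ck_on n V U f\<close> says that \<open>f\<close> is n times continuously differentiable on \<open>U\<close>, where \<open>U\<close> is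
  meant to be a relatively open subset of the linear subspace \<open>V\<close>. The derivative within \<open>U\<close>
  is then determined only on \<open>V\<close>, so only directions in \<open>V\<close> enter the recursion. As \<open>V\<close> is
  finite-dimensional, a derivative is a C^n map into the linear maps on \<open>V\<close> exactly when all
  its evaluations at directions in \<open>V\<close> are C^n.
\<close>

primrec Ck_on ::
  "nat \<Rightarrow> 'a::euclidean_space set \<Rightarrow> 'a set \<Rightarrow> ('a \<Rightarrow> 'b::real_normed_vector) \<Rightarrow> bool" where
  "Ck_on 0 V U f \<longleftrightarrow> continuous_on U f"
| "Ck_on (Suc n) V U f \<longleftrightarrow>
     (\<exists>D. (\<forall>x\<in>U. (f has_derivative D x) (at x within U)) \<and>
          (\<forall>v\<in>V. Ck_on n V U (\<lambda>x. D x v)))"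

definition smooth_on ::
  "'a::euclidean_space set \<Rightarrow> 'a set \<Rightarrow> ('a \<Rightarrow> 'b::real_normed_vector) \<Rightarrow> bool" where
  "smooth_on V U f \<longleftrightarrow> (\<forall>n. Ck_on n V U f)"

end

theory Submission
  imports Defs
begin

text \<open>
  The tensors \<open>v \<otimes> v\<close> of the nine rational unit vectors \<open>v = e\<^sub>i\<close> and \<open>v = (3 e\<^sub>i + 4 e\<^sub>j) / 5\<close>
  span the symmetric matrices, so \<open>S = \<Sum>\<^sub>v c\<^sub>v(S) v \<otimes> v\<close> with linear \<open>c\<^sub>v\<close>. Writing \<open>c\<^sub>v = (1 + c\<^sub>v) - 1\<close>
  makes all weights positive for small \<open>S\<close>; their square roots are smooth. Each \<open>v\<close> is needed once as
  a \<open>k\<^sub>1\<close> and once as a \<open>k\<^sub>2\<close>. Since the rational circle orthogonal to \<open>v\<close> is infinite, the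
  corresponding \<open>k\<close> can be chosen pairwise distinct and outside any given finite set.
\<close>

text \<open>The family \<open>b * (a + l x) powr r\<close> is closed under directional derivatives:
  direction \<open>v\<close> replaces \<open>b\<close> by \<open>b * r * l v\<close> and
  \<open>r\<close> by \<open>r - 1\<close>. Hence the induction on \<open>n\<close> with
  \<open>b\<close> and \<open>r\<close> arbitrary.\<close>

lemma Ck_on_affine_powr:
  fixes l :: "'a::euclidean_space \<Rightarrow> real"
  assumes "bounded_linear l" and pos: "\<And>x. x \<in> U \<Longrightarrow> 0 < a + l x"
  shows "Ck_on n V U (\<lambda>x. b * (a + l x) powr r)"
proof (induction n arbitrary: b r)
  case 0
  have "continuous_on U l"
    using assms(1) by (simp add: linear_continuous_on)
  moreover have "a + l x \<noteq> 0" if "x \<in> U" for x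
    using pos[OF that] by simp
  ultimately show ?case
    by (auto intro!: continuous_intros)
next
  case (Suc n)
  have "((\<lambda>x. b * (a + l x) powr r) has_derivative
      (\<lambda>v. (b * r * l v) * (a + l x) powr (r - 1))) (at x within U)" if "x \<in> U" for x
  proof -
    have l: "(l has_derivative l) (at x within U)"
      using assms(1) by (rule bounded_linear_imp_has_derivative)
    show ?thesis
      by (rule derivative_eq_intros l refl pos that | simp)+
        (use pos[OF that] in \<open>auto simp: powr_diff field_simps\<close>)
  qed
  moreover have "Ck_on n V U (\<lambda>x. (b * r * l v) * (a + l x) powr (r - 1))" for v
    by (rule Suc.IH)
  ultimately show ?case
    by (auto intro!: exI[of _ "\<lambda>x v. (b * r * l v) * (a + l x) powr (r - 1)"])
qed

text \<open>A derivative of \<open>f\<close> within \<open>U\<close> depends only on values on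
  \<open>U\<close>, so the same witness \<open>D\<close> serves for \<open>g\<close> and a case
  split replaces induction.\<close>

lemma Ck_on_cong:
  assumes "\<And>x. x \<in> U \<Longrightarrow> f x = g x" and "Ck_on n V U f"
  shows "Ck_on n V U g"
proof (cases n)
  case 0
  then show ?thesis
    using assms continuous_on_cong[of U U f g] by simp
next
  case (Suc m)
  then obtain D where D: "\<And>x. x \<in> U \<Longrightarrow> (f has_derivative D x) (at x within U)"
      "\<And>v. v \<in> V \<Longrightarrow> Ck_on m V U (\<lambda>x. D x v)"
    using assms(2) by auto
  have "(g has_derivative D x) (at x within U)" if "x \<in> U" for x
    using D(1)[OF that] by (rule has_derivative_transform[OF that, rotated]) (simp add: assms(1))
  with D(2) Suc show ?thesis by auto
qed

lemma smooth_on_sqrt_affine: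
  fixes l :: "'a::euclidean_space \<Rightarrow> real"
  assumes "bounded_linear l" and "\<And>x. x \<in> U \<Longrightarrow> 0 < a + l x"
  shows "smooth_on V U (\<lambda>x. sqrt (a + l x))"
  unfolding smooth_on_def
proof
  fix n
  show "Ck_on n V U (\<lambda>x. sqrt (a + l x))"
    using Ck_on_affine_powr[OF assms, of U n V 1 "1/2"]
    by (rule Ck_on_cong[rotated]) (auto simp: powr_half_sqrt less_imp_le assms(2))
qed

text \<open>Three pairwise orthogonal unit vectors are independent, hence span a space of dimension
  3.\<close>

lemma rational_orthonormal_basis_iff:
  "rational_orthonormal_basis u v w \<longleftrightarrow>
     {u, v, w} \<subseteq> rational_sphere \<and> u \<bullet> v = 0 \<and> u \<bullet> w = 0 \<and> v \<bullet> w = 0"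
proof -
  have "span {u, v, w} = UNIV"
    if "norm u = 1" "norm v = 1" "norm w = 1" "u \<bullet> v = 0" "u \<bullet> w = 0" "v \<bullet> w = 0"
  proof -
    have "independent {u, v, w}"
      using that by (intro pairwise_orthogonal_independent)
        (auto simp: pairwise_def orthogonal_def inner_commute)
    moreover have "u \<noteq> v" "u \<noteq> w" "v \<noteq> w"
      using that by (auto simp: dot_square_norm)
    then have "card {u, v, w} = 3" by simp
    ultimately show ?thesis
      using card_ge_dim_independent[of "{u, v, w}" UNIV] by auto
  qed
  then show ?thesis
    by (auto simp: rational_orthonormal_basis_def orthonormal_basis3_def rational_sphere_def)
qed

text \<open>The pair \<open>p, q\<close> is rotated in the plane orthogonal to \<open>v\<close>; a
  rational cosine \<open>x\<close> and sine \<open>y\<close> keep the coordinates rational.\<close>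

lemma rational_orthonormal_basis_rotate:
  assumes "rational_orthonormal_basis v p q" and "x \<in> \<rat>" "y \<in> \<rat>" "x\<^sup>2 + y\<^sup>2 = 1"
  shows "rational_orthonormal_basis v (x *\<^sub>R p + y *\<^sub>R q) (x *\<^sub>R q - y *\<^sub>R p)"
proof -
  have o: "v \<bullet> p = 0" "v \<bullet> q = 0" "p \<bullet> q = 0" "q \<bullet> p = 0" "p \<bullet> p = 1" "q \<bullet> q = 1"
    using assms(1)
    by (auto simp: rational_orthonormal_basis_iff rational_sphere_def dot_square_norm inner_commute)
  have "norm (x *\<^sub>R p + y *\<^sub>R q) = 1" "norm (x *\<^sub>R q - y *\<^sub>R p) = 1"
    using assms(4) by (auto simp: norm_eq_1 o algebra_simps power2_eq_square)
  then show ?thesis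
    using assms by (auto simp: rational_orthonormal_basis_iff rational_sphere_def o algebra_simps)
qed

lemma infinite_rational_orthonormal_completions:
  assumes "rational_orthonormal_basis v p q"
  shows "infinite {k. \<exists>w. rational_orthonormal_basis v k w}"
proof -
  \<comment> \<open>The standard rational parametrisation of the unit circle, with \<open>n\<close>
    the tangent of half the angle.\<close>
  define x :: "nat \<Rightarrow> real" where "x n = (1 - (real n)\<^sup>2) / (1 + (real n)\<^sup>2)" for n
  define y :: "nat \<Rightarrow> real" where "y n = 2 * real n / (1 + (real n)\<^sup>2)" for n
  define k where "k n = x n *\<^sub>R p + y n *\<^sub>R q" for n
  have nz: "1 + (real n)\<^sup>2 \<noteq> 0" for n
    by (smt (verit) zero_le_power2)
  have circ: "(x n)\<^sup>2 + (y n)\<^sup>2 = 1" for n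
    using nz[of n] by (simp add: x_def y_def power_divide divide_simps) (simp add: power2_eq_square algebra_simps)
  have "rational_orthonormal_basis v (k n) (x n *\<^sub>R q - y n *\<^sub>R p)" for n
    unfolding k_def by (rule rational_orthonormal_basis_rotate[OF assms _ _ circ]) (auto simp: x_def y_def)
  then have sub: "range k \<subseteq> {k. \<exists>w. rational_orthonormal_basis v k w}" by blast
  \<comment> \<open>The component along \<open>p\<close> is \<open>x n = 2 / (1 + n^2) - 1\<close>,
    which determines the natural number \<open>n\<close>.\<close>
  have "inj k"
  proof (rule injI)
    fix m n assume "k m = k n"
    then have "k m \<bullet> p = k n \<bullet> p" by simp
    then have "x m = x n"
      using assms by (simp add: k_def rational_orthonormal_basis_iff rational_sphere_def
          inner_add_left dot_square_norm inner_commute[of q p])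
    then have "(real m)\<^sup>2 = (real n)\<^sup>2"
      using nz[of m] nz[of n] by (simp add: x_def field_simps)
    then show "m = n" by simp
  qed
  then show ?thesis
    using sub finite_subset range_inj_infinite by blast
qed

text \<open>Greedy choice: at each step only \<open>F\<close> and the finitely many earlier values
  are excluded from an infinite set.\<close>

lemma inj_on_choice_avoiding:
  assumes "finite I" and "\<And>i. i \<in> I \<Longrightarrow> infinite (A i)" and "finite F"
  shows "\<exists>f. inj_on f I \<and> (\<forall>i\<in>I. f i \<in> A i - F)"
  using assms(1,2)
proof (induction I rule: finite_induct)
  case empty
  then show ?case by simp
next
  case (insert i I)
  then obtain f where f: "inj_on f I" "\<forall>i\<in>I. f i \<in> A i - F" by auto
  have "infinite (A i - (F \<union> f ` I))"
    using insert assms(3) by (simp add: Diff_infinite_finite)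
  then obtain a where a: "a \<in> A i" "a \<notin> F" "a \<notin> f ` I"
    by (metis DiffD1 DiffD2 UnCI finite.emptyI ex_in_conv)
  have "inj_on (f(i := a)) (insert i I)"
    using f(1) a(3) insert(2) by (auto simp: inj_on_def)
  moreover have "\<forall>j\<in>insert i I. (f(i := a)) j \<in> A j - F"
    using f(2) a insert(2) by auto
  ultimately show ?case by blast
qed

text \<open>The triple 3, 4, 5 gives rational unit vectors. Both orders of a pair occur, so nine
  tensors span a space of dimension six.\<close>

definition frame_vec :: "3 \<times> 3 \<Rightarrow> real^3" where
  "frame_vec = (\<lambda>(i, j). if i = j then axis i 1 else (3/5) *\<^sub>R axis i 1 + (4/5) *\<^sub>R axis j 1)"

text \<open>For symmetric \<open>S\<close> and \<open>i \<noteq> j\<close>, the pairs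
  \<open>(i, j)\<close> and \<open>(j, i)\<close> get equal coefficients. Each tensor has
  off-diagonal entry 12/25, so together they produce \<open>S $ i $ j\<close> when the coefficient
  is 25/24 of it. Their diagonal parts 9/25 and 16/25 add up to 1, and the axis terms subtract this
  surplus.\<close>

definition frame_coeff :: "3 \<times> 3 \<Rightarrow> real^3^3 \<Rightarrow> real" where
  "frame_coeff = (\<lambda>(i, j) S.
     if i = j then S $ i $ i - (25/24) * (\<Sum>l\<in>-{i}. S $ i $ l) else (25/24) * S $ i $ j)"

lemma frame_vec_completion: "\<exists>p q. rational_orthonormal_basis (frame_vec ij) p q"
proof (cases ij)
  case (Pair i j)
  have axis: "axis l 1 \<in> rational_sphere" for l :: 3
    by (auto simp: rational_sphere_def) (simp add: axis_def)
  have third: "\<exists>l::3. l \<noteq> a \<and> l \<noteq> b" for a b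
    using exhaust_3[of a] exhaust_3[of b] by (rule_tac ccontr) (auto simp: forall_3)
  have oa: "axis a (1::real) \<bullet> axis b 1 = (if a = b then 1 else 0)" for a b :: 3
    by (simp add: inner_axis_axis)
  show ?thesis
  proof (cases "i = j")
    case True
    obtain l m :: 3 where "l \<noteq> i" "m \<noteq> i" "l \<noteq> m"
      using third by metis
    then have "rational_orthonormal_basis (frame_vec ij) (axis l 1) (axis m 1)"
      using Pair True axis by (simp add: frame_vec_def rational_orthonormal_basis_iff oa)
    then show ?thesis by blast
  next
    case False
    obtain l :: 3 where l: "l \<noteq> i" "l \<noteq> j"
      using third by metis
    have "rational_orthonormal_basis (axis l 1) (axis i 1) (axis j 1)"
      using l False axis by (simp add: rational_orthonormal_basis_iff oa)
    \<comment> \<open>Rotating about the third axis carries \<open>axis i 1\<close> to the frame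
      vector and \<open>axis j 1\<close> to its second companion.\<close>
    from rational_orthonormal_basis_rotate[OF this, of "3/5" "4/5"]
    have "rational_orthonormal_basis (axis l 1) (frame_vec ij) ((3/5) *\<^sub>R axis j 1 - (4/5) *\<^sub>R axis i 1)"
      using Pair False by (simp add: frame_vec_def power2_eq_square)
    then have "rational_orthonormal_basis (frame_vec ij) (axis l 1) ((3/5) *\<^sub>R axis j 1 - (4/5) *\<^sub>R axis i 1)"
      by (simp add: rational_orthonormal_basis_iff inner_commute)
    then show ?thesis by blast
  qed
qed

lemma Compl_3: "- {1::3} = {2, 3}" "- {2::3} = {1, 3}" "- {3::3} = {1, 2}"
  using exhaust_3 by auto

lemma frame_decomposition:
  assumes "S \<in> Sym3"
  shows "(\<Sum>p\<in>UNIV. frame_coeff p S *\<^sub>R (frame_vec p \<otimes> frame_vec p)) = S"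
proof -
  have "S $ i $ j = S $ j $ i" for i j
    using assms unfolding Sym3_def by (metis (mono_tags) mem_Collect_eq transpose_def vec_lambda_beta)
  then have sym: "S $ 2 $ 1 = S $ 1 $ 2" "S $ 3 $ 1 = S $ 1 $ 3" "S $ 3 $ 2 = S $ 2 $ 3"
    by auto
  show ?thesis
    unfolding UNIV_Times_UNIV[symmetric] sum.cartesian_product'
    by (simp add: vec_eq_iff forall_3 sum_3 frame_coeff_def frame_vec_def tensor_def axis_def Compl_3 sym
        field_simps)
qed

lemma bounded_linear_frame_coeff: "bounded_linear (frame_coeff p)"
proof -
  have "bounded_linear (\<lambda>S::real^3^3. S $ i $ j)" for i j
    by (rule bounded_linear_compose[OF bounded_linear_vec_nth bounded_linear_vec_nth])
  then show ?thesis
    by (cases p; cases "fst p = snd p")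
      (auto simp: frame_coeff_def simp del: times_divide_eq_left intro!: bounded_linear_sub bounded_linear_const_mult bounded_linear_sum)
qed

text \<open>Each \<open>c i\<close> is continuous and vanishes at 0, and finitely many
  neighbourhoods of 0 contain a common ball. The bound 1 keeps \<open>1 + c i x\<close>
  positive.\<close>

lemma bounded_linear_finite_bound:
  fixes c :: "'i \<Rightarrow> 'a::real_normed_vector \<Rightarrow> real"
  assumes "finite I" and "\<And>i. i \<in> I \<Longrightarrow> bounded_linear (c i)"
  shows "\<exists>\<epsilon>>0. \<forall>i\<in>I. \<forall>x\<in>ball 0 \<epsilon>. \<bar>c i x\<bar> < 1"
proof -
  have "\<forall>\<^sub>F x in nhds 0. \<bar>c i x\<bar> < 1" if "i \<in> I" for i
  proof -
    interpret bounded_linear "c i" by (rule assms(2)[OF that])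
    have "(c i \<longlongrightarrow> c i 0) (nhds 0)"
      using linear_continuous_at[OF assms(2)[OF that], of 0] by (simp only: isCont_def tendsto_at_iff_tendsto_nhds)
    then show ?thesis
      by (auto simp: tendsto_iff dist_norm zero elim!: allE[of _ 1])
  qed
  then have "\<forall>\<^sub>F x in nhds 0. \<forall>i\<in>I. \<bar>c i x\<bar> < 1"
    using assms(1) by (simp add: eventually_ball_finite)
  then show ?thesis
    by (auto simp: eventually_nhds_metric dist_commute)
qed

theorem lemma3p2:
  fixes \<Lambda>\<^sub>N :: "(real^3) set"
    and \<Lambda>\<^sub>N\<^sub>i :: "nat \<Rightarrow> (real^3) set"
    and n1 n2 :: "real^3 \<Rightarrow> real^3"
    and \<gamma>\<^sub>N :: "real^3 \<Rightarrow> real^3^3 \<Rightarrow> real"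
    and \<epsilon>\<^sub>N :: real
  assumes N_finite: "finite \<Lambda>\<^sub>N"
    and N_subset: "\<Lambda>\<^sub>N \<subseteq> rational_sphere"
    and N_union: "\<Lambda>\<^sub>N = (\<Union>i\<in>{1..3}. \<Lambda>\<^sub>N\<^sub>i i)"
    and N_disjoint: "disjoint_family_on \<Lambda>\<^sub>N\<^sub>i {1..3}"
    and N_basis: "\<And>k. k \<in> \<Lambda>\<^sub>N \<Longrightarrow> rational_orthonormal_basis k (n1 k) (n2 k)"
    and N_eps: "\<epsilon>\<^sub>N > 0"
    and N_smooth: "\<And>k. k \<in> \<Lambda>\<^sub>N \<Longrightarrow> smooth_on Skew3 (B_skew3 \<epsilon>\<^sub>N) (\<gamma>\<^sub>N k)"
    and N_pos: "\<And>k A. k \<in> \<Lambda>\<^sub>N \<Longrightarrow> A \<in> B_skew3 \<epsilon>\<^sub>N \<Longrightarrow> \<gamma>\<^sub>N k A > 0"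
    and N_decomp: "\<And>i A. i \<in> {1..3} \<Longrightarrow> A \<in> B_skew3 \<epsilon>\<^sub>N \<Longrightarrow>
      A = (\<Sum>k\<in>\<Lambda>\<^sub>N\<^sub>i i. (\<gamma>\<^sub>N k A)\<^sup>2 *\<^sub>R (n2 k \<otimes> n1 k - n1 k \<otimes> n2 k))"
  shows "\<exists>(\<epsilon>\<^sub>m::real) (\<Lambda>\<^sub>m::(real^3) set) (\<Lambda>\<^sub>m\<^sub>1::(real^3) set) (\<Lambda>\<^sub>m\<^sub>2::(real^3) set)
           (\<Lambda>\<^sub>m\<^sub>2\<^sub>i::nat \<Rightarrow> (real^3) set)
           (k1::real^3 \<Rightarrow> real^3) (k2::real^3 \<Rightarrow> real^3)
           (\<gamma>::real^3 \<Rightarrow> real^3^3 \<Rightarrow> real).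
      \<epsilon>\<^sub>m > 0 \<and>
      finite \<Lambda>\<^sub>m \<and> \<Lambda>\<^sub>m \<subseteq> rational_sphere \<and>
      (\<forall>k\<in>\<Lambda>\<^sub>m. rational_orthonormal_basis k (k1 k) (k2 k)) \<and>
      \<Lambda>\<^sub>m = \<Lambda>\<^sub>m\<^sub>1 \<union> \<Lambda>\<^sub>m\<^sub>2 \<and>
      \<Lambda>\<^sub>m\<^sub>2 = (\<Union>i\<in>{1..3}. \<Lambda>\<^sub>m\<^sub>2\<^sub>i i) \<and>
      (\<forall>k\<in>\<Lambda>\<^sub>m. smooth_on Sym3 (B_sym3 \<epsilon>\<^sub>m) (\<gamma> k)) \<and>
      (\<forall>k\<in>\<Lambda>\<^sub>m. \<forall>S\<in>B_sym3 \<epsilon>\<^sub>m. \<gamma> k S > 0) \<and>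
      (\<forall>S\<in>B_sym3 \<epsilon>\<^sub>m.
         S = (\<Sum>k\<in>\<Lambda>\<^sub>m\<^sub>1. (\<gamma> k S)\<^sup>2 *\<^sub>R (k1 k \<otimes> k1 k))
             - (\<Sum>i=1..3. \<Sum>k\<in>\<Lambda>\<^sub>m\<^sub>2\<^sub>i i. (\<gamma> k S)\<^sup>2 *\<^sub>R (k2 k \<otimes> k2 k))) \<and>
      \<Lambda>\<^sub>N \<inter> \<Lambda>\<^sub>m = {} \<and>
      \<Lambda>\<^sub>m\<^sub>1 \<inter> \<Lambda>\<^sub>m\<^sub>2 = {}"
proof -
  \<comment> \<open>The Boolean tag makes two copies of each frame vector: \<open>True\<close> for
    its use as \<open>k1\<close>, \<open>False\<close> for its use as \<open>k2\<close>. Injectivity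
    of \<open>f\<close> on tagged indices later separates the two families.\<close>
  have "infinite {k. \<exists>w. rational_orthonormal_basis (frame_vec (fst pb)) k w}" for pb :: "(3 \<times> 3) \<times> bool"
    using frame_vec_completion infinite_rational_orthonormal_completions by blast
  with N_finite inj_on_choice_avoiding[of "UNIV :: ((3 \<times> 3) \<times> bool) set"
      "\<lambda>pb. {k. \<exists>w. rational_orthonormal_basis (frame_vec (fst pb)) k w}" \<Lambda>\<^sub>N]
  obtain f :: "(3 \<times> 3) \<times> bool \<Rightarrow> real^3" where inj: "inj f" and avoid: "\<And>pb. f pb \<notin> \<Lambda>\<^sub>N"
    and "\<And>pb. \<exists>w. rational_orthonormal_basis (frame_vec (fst pb)) (f pb) w"
    by auto
  then obtain w where w: "\<And>pb. rational_orthonormal_basis (frame_vec (fst pb)) (f pb) (w pb)"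
    by metis
  obtain \<epsilon> where \<epsilon>: "\<epsilon> > 0" and small: "\<And>p S. S \<in> ball 0 \<epsilon> \<Longrightarrow> \<bar>frame_coeff p S\<bar> < 1"
    using bounded_linear_finite_bound[of "UNIV :: (3 \<times> 3) set" frame_coeff] bounded_linear_frame_coeff
    by auto

  define k1 where "k1 k = (let pb = inv f k in if snd pb then frame_vec (fst pb) else w pb)" for k
  define k2 where "k2 k = (let pb = inv f k in if snd pb then w pb else frame_vec (fst pb))" for k
  \<comment> \<open>On the \<open>False\<close> copies \<open>l\<close> is 0, so
    \<open>\<gamma>\<close> is constantly 1 there; on the \<open>True\<close> copies its square is
    one plus the frame coefficient.\<close>
  define l where "l k S = (let pb = inv f k in if snd pb then frame_coeff (fst pb) S else 0)" for k S
  define \<gamma> where "\<gamma> k S = sqrt (1 + l k S)" for k S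
  define \<Lambda>1 where "\<Lambda>1 = range (\<lambda>p. f (p, True))"
  define \<Lambda>2 where "\<Lambda>2 = range (\<lambda>p. f (p, False))"
  \<comment> \<open>The whole second family is placed at index 1; indices 2 and 3 get the empty set
    and contribute zero sums.\<close>
  define \<Lambda>2i where "\<Lambda>2i i = (if i = (1::nat) then \<Lambda>2 else {})" for i

  have inv: "inv f (f pb) = pb" for pb
    using inj by simp
  have lin: "bounded_linear (l k)" for k
    using bounded_linear_frame_coeff by (cases "snd (inv f k)") (simp_all add: l_def[abs_def] Let_def)
  have pos: "0 < 1 + l k S" if "S \<in> B_sym3 \<epsilon>" for k S
    using small[of S "fst (inv f k)"] that by (auto simp: l_def Let_def B_sym3_def)
  \<comment> \<open>Orthonormality is symmetric in the three vectors, so \<open>f pb\<close> may be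
    moved to the front and the other two ordered by the tag.\<close>
  have basis: "rational_orthonormal_basis (f pb) (k1 (f pb)) (k2 (f pb))" for pb
    using w[of pb] by (auto simp: k1_def k2_def inv Let_def rational_orthonormal_basis_iff inner_commute)
  have decomp: "S = (\<Sum>k\<in>\<Lambda>1. (\<gamma> k S)\<^sup>2 *\<^sub>R (k1 k \<otimes> k1 k))
      - (\<Sum>i=1..3. \<Sum>k\<in>\<Lambda>2i i. (\<gamma> k S)\<^sup>2 *\<^sub>R (k2 k \<otimes> k2 k))" if S: "S \<in> B_sym3 \<epsilon>" for S
  proof -
    have sq: "(\<gamma> k S)\<^sup>2 = 1 + l k S" for k
      using pos[OF S, of k] by (simp add: \<gamma>_def)
    have inj': "inj (\<lambda>p. f (p, b))" for b
      using inj by (auto simp: inj_def)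
    have "(\<Sum>k\<in>\<Lambda>1. (\<gamma> k S)\<^sup>2 *\<^sub>R (k1 k \<otimes> k1 k))
        = (\<Sum>p\<in>UNIV. (1 + frame_coeff p S) *\<^sub>R (frame_vec p \<otimes> frame_vec p))"
      unfolding \<Lambda>1_def sum.reindex[OF inj'] by (simp add: sq l_def k1_def inv)
    moreover have "(\<Sum>i=1..3. \<Sum>k\<in>\<Lambda>2i i. (\<gamma> k S)\<^sup>2 *\<^sub>R (k2 k \<otimes> k2 k))
        = (\<Sum>k\<in>\<Lambda>2. (\<gamma> k S)\<^sup>2 *\<^sub>R (k2 k \<otimes> k2 k))"
      by (simp add: \<Lambda>2i_def eval_nat_numeral)
    moreover have "\<dots> = (\<Sum>p\<in>UNIV. frame_vec p \<otimes> frame_vec p)"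
      unfolding \<Lambda>2_def sum.reindex[OF inj'] by (simp add: sq l_def k2_def inv)
    moreover have "S \<in> Sym3"
      using S by (simp add: B_sym3_def)
    \<comment> \<open>The summand 1 in each weight of the first sum cancels against the second sum,
      leaving the frame decomposition of \<open>S\<close>.\<close>
    ultimately show ?thesis
      using frame_decomposition[of S] by (simp add: scaleR_add_left sum.distrib)
  qed
  show ?thesis
  proof (intro exI conjI ballI)
    show "finite (\<Lambda>1 \<union> \<Lambda>2)" by (simp add: \<Lambda>1_def \<Lambda>2_def)
    show "\<Lambda>1 \<union> \<Lambda>2 \<subseteq> rational_sphere"
      using basis by (auto simp: \<Lambda>1_def \<Lambda>2_def rational_orthonormal_basis_iff)
    show "rational_orthonormal_basis k (k1 k) (k2 k)" if "k \<in> \<Lambda>1 \<union> \<Lambda>2" for k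
      using that basis by (auto simp: \<Lambda>1_def \<Lambda>2_def)
    show "\<Lambda>2 = (\<Union>i\<in>{1..3}. \<Lambda>2i i)" by (auto simp: \<Lambda>2i_def split: if_splits)
    show "smooth_on Sym3 (B_sym3 \<epsilon>) (\<gamma> k)" for k
      unfolding \<gamma>_def[abs_def] by (rule smooth_on_sqrt_affine[OF lin pos])
    show "\<gamma> k S > 0" if "S \<in> B_sym3 \<epsilon>" for k S
      using pos[OF that] by (simp add: \<gamma>_def)
    show "\<Lambda>\<^sub>N \<inter> (\<Lambda>1 \<union> \<Lambda>2) = {}"
      using avoid by (auto simp: \<Lambda>1_def \<Lambda>2_def)
    show "\<Lambda>1 \<inter> \<Lambda>2 = {}"
      using inj by (auto simp: \<Lambda>1_def \<Lambda>2_def inj_eq)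
  qed (use \<epsilon> decomp in auto)
qed

end
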